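(* Let $\mu\preceq_{\mathrm{st}}\nu$ be Borel probability measures on $\mathbb{R}$. The optimal directional coupling satisfies $$P_*(\mu,\nu)=\mathrm{Id}(\mu\wedge\nu)+P_*(\mu',\nu'),$$ where $\mathrm{Id}(\mu\wedge\nu)=(\mu\wedge\nu)\otimes_x\delta_x$ is the identical coupling of $\mu\wedge\nu$ with itself (the pushforward of $\mu\wedge\nu$ under $x\mapsto(x,x)$), and $\mu'=\mu-\mu\wedge\nu$ and $\nu'=\nu-\mu\wedge\nu$ are the mutually singular parts of $\mu$ and $\nu$.
   Context: For finite Borel measures $\theta_1,\theta_2$ on $\mathbb{R}$ with cdf's $F_{\theta_i}(t)=\theta_i((-\infty,t])$, $\theta_1\preceq_{\mathrm{st}}\theta_2$ means $\theta_1(\mathbb{R})=\theta_2(\mathbb{R})$ and $F_{\theta_1}\ge F_{\theta_2}$; $\theta_1\le\theta_2$ means $\theta_1(A)\le\theta_2(A)$ for all Borel $A$. The common part $\mu\wedge\nu$ is the measure with $\frac{d(\mu\wedge\nu)}{d(\mu+\nu)}=\frac{d\mu}{d(\mu+\nu)}\wedge\frac{d\nu}{d(\mu+\nu)}$; equivalently, the maximal measure $\theta$ with $\theta\le\mu$ and $\theta\le\nu$. For finite measures $\alpha\preceq_{\mathrm{st}}\beta$ on $\mathbb{R}$, a directional coupling is a measure on $\mathbb{R}^2$ with first marginal $\alpha$ and second marginal $\beta$ concentrated on $\mathbb{H}=\{(x,y):y\ge x\}$. $P_*(\alpha,\beta)$ denotes the optimal directional coupling: the unique directional coupling $P$ of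 $\alpha,\beta$ such that $P((x,\infty)\times\cdot)=\beta_x$ for all $x\in\mathbb{R}$, where $\beta_x$ is the unique minimal element for $\preceq_{\mathrm{st}}$ of $\{\theta:\alpha|_{(x,\infty)}\preceq_{\mathrm{st}}\theta\le\beta\}$ (equivalently, $F_{\beta_x}$ is the supremum of $F_\theta$ over this set). Existence and uniqueness hold whenever $\alpha\preceq_{\mathrm{st}}\beta$. (One has $\mu'\preceq_{\mathrm{st}}\nu'$ since $F_{\mu'}-F_{\nu'}=F_\mu-F_\nu$.) *)

theory Defs
  imports "HOL-Probability.Probability"
begin

definition st_le :: "real measure \<Rightarrow> real measure \<Rightarrow> bool" (infix "\<preceq>\<^sub>s\<^sub>t" 50)
  where "\<theta>\<^sub>1 \<preceq>\<^sub>s\<^sub>t \<theta>\<^sub>2 \<longleftrightarrow>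
    measure \<theta>\<^sub>1 UNIV = measure \<theta>\<^sub>2 UNIV \<and> (\<forall>t. cdf \<theta>\<^sub>2 t \<le> cdf \<theta>\<^sub>1 t)"

text \<open>The sum of two measures on the same sigma-algebra, in the style of \<^const>\<open>diff_measure\<close>.\<close>

definition add_measure :: "'a measure \<Rightarrow> 'a measure \<Rightarrow> 'a measure"
  where "add_measure M N = measure_of (space M) (sets M) (\<lambda>A. emeasure M A + emeasure N A)"

lemma space_add_measure [simp]: "space (add_measure M N) = space M"
  and sets_add_measure [simp, measurable_cong]: "sets (add_measure M N) = sets M"
  by (auto simp: add_measure_def)

lemma emeasure_add_measure:
  assumes "sets M = sets N" and "A \<in> sets M"
  shows "emeasure (add_measure M N) A = emeasure M A + emeasure N A"
  unfolding add_measure_def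
proof (rule emeasure_measure_of_sigma)
  show "sigma_algebra (space M) (sets M)" ..
  show "positive (sets M) (\<lambda>A. emeasure M A + emeasure N A)"
    by (simp add: positive_def)
  show "countably_additive (sets M) (\<lambda>A. emeasure M A + emeasure N A)"
  proof (rule countably_additiveI)
    fix B :: "nat \<Rightarrow> _"
    assume B: "range B \<subseteq> sets M" "disjoint_family B"
    then have "(\<Sum>i. emeasure M (B i)) = emeasure M (\<Union>i. B i)"
      and "(\<Sum>i. emeasure N (B i)) = emeasure N (\<Union>i. B i)"
      using assms(1) by (auto intro!: suminf_emeasure)
    then show "(\<Sum>i. emeasure M (B i) + emeasure N (B i)) =
        emeasure M (\<Union>i. B i) + emeasure N (\<Union>i. B i)"
      by (simp add: suminf_add[symmetric])
  qed
qed fact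

text \<open>Note that \<^term>\<open>RN_deriv M N\<close> is the density of \<^term>\<open>N\<close> with respect to \<^term>\<open>M\<close>.\<close>

definition common_part :: "'a measure \<Rightarrow> 'a measure \<Rightarrow> 'a measure"
  where "common_part \<mu> \<nu> =
    density (add_measure \<mu> \<nu>)
      (\<lambda>x. min (RN_deriv (add_measure \<mu> \<nu>) \<mu> x) (RN_deriv (add_measure \<mu> \<nu>) \<nu> x))"

definition Id_coupling :: "real measure \<Rightarrow> (real \<times> real) measure"
  where "Id_coupling \<theta> = distr \<theta> borel (\<lambda>x. (x, x))"

definition directional_coupling ::
    "real measure \<Rightarrow> real measure \<Rightarrow> (real \<times> real) measure \<Rightarrow> bool"
  where "directional_coupling \<alpha> \<beta> P \<longleftrightarrow>
    sets P = sets borel \<and> distr P borel fst = \<alpha> \<and> distr P borel snd = \<beta> \<and>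
    (AE (x, y) in P. x \<le> y)"

text \<open>
  The restriction of \<^term>\<open>\<alpha>\<close> to the half-line above \<^term>\<open>x\<close> has to remain a measure on the
  whole real line, so it is written as a \<^const>\<open>density\<close> rather than with \<^const>\<open>restrict_space\<close>.
  The order \<^term>\<open>\<theta> \<le> \<beta>\<close> on measures is setwise, as both are Borel measures.
\<close>

definition dominating_submeasures :: "real measure \<Rightarrow> real measure \<Rightarrow> real \<Rightarrow> real measure set"
  where "dominating_submeasures \<alpha> \<beta> x =
    {\<theta>. finite_borel_measure \<theta> \<and> density \<alpha> (indicator {x<..}) \<preceq>\<^sub>s\<^sub>t \<theta> \<and> \<theta> \<le> \<beta>}"

definition opt_target :: "real measure \<Rightarrow> real measure \<Rightarrow> real \<Rightarrow> real measure"
  where "opt_target \<alpha> \<beta> x =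
    (THE \<theta>. \<theta> \<in> dominating_submeasures \<alpha> \<beta> x \<and>
      (\<forall>\<theta>' \<in> dominating_submeasures \<alpha> \<beta> x. \<theta>' \<preceq>\<^sub>s\<^sub>t \<theta> \<longrightarrow> \<theta>' = \<theta>))"

definition opt_directional_coupling ::
    "real measure \<Rightarrow> real measure \<Rightarrow> (real \<times> real) measure"
  where "opt_directional_coupling \<alpha> \<beta> =
    (THE P. directional_coupling \<alpha> \<beta> P \<and>
      (\<forall>x. \<forall>B \<in> sets borel. emeasure P ({x<..} \<times> B) = emeasure (opt_target \<alpha> \<beta> x) B))"

end

theory Submission
  imports Defs
begin

text \<open>
  Everything rests on an explicit formula for the target measures. For \<open>\<alpha>\<close> dominated by \<open>\<beta>\<close> in
  the stochastic order put \<open>D = F\<^sub>\<alpha> - F\<^sub>\<beta> \<ge> 0\<close>. A measure \<open>\<theta> \<le> \<beta>\<close> that stochastically dominates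
  the restriction of \<open>\<alpha>\<close> to \<open>(x, \<infinity>)\<close> can gain at most \<open>F\<^sub>\<beta>(t) - F\<^sub>\<beta>(s)\<close> between \<open>s\<close> and \<open>t\<close> and
  has at most \<open>F\<^sub>\<alpha>(s) - F\<^sub>\<alpha>(x)\<close> up to \<open>s\<close>; optimising over \<open>s \<in> [x, t]\<close> gives
  \<open>F\<^sub>\<theta>(t) \<le> F\<^sub>\<beta>(t) - F\<^sub>\<alpha>(x) + inf\<^bsub>[x,t]\<^esub> D\<close>. The right-hand side is itself the cdf of an admissible
  measure, so it is the cdf of the target of \<open>\<alpha>\<close> and \<open>\<beta>\<close> at \<open>x\<close> (\<open>opt_target_eq\<close>).

  Subtracting a common part \<open>\<theta>\<close> from \<open>\<alpha>\<close> and \<open>\<beta>\<close> leaves \<open>D\<close> unchanged. By the formula, the target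
  at \<open>x\<close> then loses exactly the restriction of \<open>\<theta>\<close> to \<open>(x, \<infinity>)\<close> (\<open>opt_target_add_common\<close>), and
  this is the amount of mass that the identical coupling of \<open>\<theta>\<close> sends from \<open>(x, \<infinity>)\<close>. Hence, if \<open>P\<close>
  has the defining properties of the optimal coupling of the reduced pair, then \<open>P\<close> plus the
  identical coupling has those of the optimal coupling of \<open>\<alpha>\<close> and \<open>\<beta>\<close>
  (\<open>is_opt_directional_coupling_add_common\<close>).

  This identifies the two sides once the optimal coupling of the reduced pair is known to exist and
  optimal couplings are known to be unique. Uniqueness holds because the sets \<open>(x, \<infinity>) \<times> B\<close> generate
  the Borel sets of the plane. For existence, the targets decrease in \<open>x\<close>, with total mass that is
  right-continuous and tends to the total mass of \<open>\<beta>\<close> and to \<open>0\<close> at the two ends; every family of this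
  kind is the family of tails of a measure on a product space
  (\<open>exists_measure_with_tail_family\<close>).
\<close>

section \<open>Finite Borel measures and their distribution functions\<close>

lemma
  assumes M: "finite_borel_measure M" and N: "finite_borel_measure N"
  shows finite_borel_measure_add_measure: "finite_borel_measure (add_measure M N)"
    and cdf_add_measure: "cdf (add_measure M N) t = cdf M t + cdf N t"
proof -
  interpret M: finite_borel_measure M by fact
  interpret N: finite_borel_measure N by fact
  have sets: "sets M = sets N"
    by (simp add: M.M_is_borel N.M_is_borel)
  show "finite_borel_measure (add_measure M N)"
  proof (intro finite_borel_measure.intro finite_borel_measure_axioms.intro finite_measureI)
    show "emeasure (add_measure M N) (space (add_measure M N)) \<noteq> \<infinity>"
      by (simp add: emeasure_add_measure[OF sets] M.borel_UNIV M.M_is_borel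
          M.emeasure_eq_measure N.emeasure_eq_measure)
  qed (simp add: M.M_is_borel)
  have "emeasure (add_measure M N) {..t} = ennreal (cdf M t + cdf N t)"
    by (simp add: emeasure_add_measure[OF sets] M.M_is_borel M.emeasure_eq_measure
        N.emeasure_eq_measure cdf_def)
  then show "cdf (add_measure M N) t = cdf M t + cdf N t"
    unfolding cdf_def2[of "add_measure M N"]
    by (intro measure_eq_emeasure_eq_ennreal add_nonneg_nonneg M.cdf_nonneg N.cdf_nonneg)
qed

lemma add_measure_diff_measure:
  assumes "finite_measure M" "finite_measure N" and sets: "sets N = sets M" and le: "N \<le> M"
  shows "add_measure N (diff_measure M N) = M"
proof (rule measure_eqI)
  have le': "emeasure N A \<le> emeasure M A" for A
    using le sets by (subst (asm) le_measure) (auto simp: emeasure_notin_sets)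
  fix A assume "A \<in> sets (add_measure N (diff_measure M N))"
  then have A: "A \<in> sets M" by (simp add: sets)
  have "emeasure (add_measure N (diff_measure M N)) A =
      emeasure N A + (emeasure M A - emeasure N A)"
    using A sets le' assms(1,2) by (simp add: emeasure_add_measure emeasure_diff_measure)
  also have "\<dots> = emeasure M A"
    by (rule add_diff_inverse_ennreal) (rule le')
  finally show "emeasure (add_measure N (diff_measure M N)) A = emeasure M A" .
qed (simp add: sets)

lemma finite_borel_measure_diff_measure:
  assumes M: "finite_borel_measure M" and N: "finite_borel_measure N" and le: "N \<le> M"
  shows "finite_borel_measure (diff_measure M N)"
proof -
  interpret M: finite_borel_measure M by fact
  interpret N: finite_borel_measure N by fact
  have le': "emeasure N A \<le> emeasure M A" for A
    using le by (subst (asm) le_measure) (auto simp: emeasure_notin_sets M.M_is_borel N.M_is_borel)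
  show ?thesis
  proof (intro finite_borel_measure.intro finite_borel_measure_axioms.intro finite_measureI)
    show "emeasure (diff_measure M N) (space (diff_measure M N)) \<noteq> \<infinity>"
      using emeasure_diff_measure[OF M.finite_measure_axioms N.finite_measure_axioms _ le']
      by (simp add: M.M_is_borel N.M_is_borel M.borel_UNIV M.emeasure_eq_measure
          N.emeasure_eq_measure ennreal_minus)
  qed (simp add: M.M_is_borel)
qed

text \<open>
  The difference of the two cdfs is again the cdf of a measure, which is what has to be added to
  the smaller measure to obtain the larger one.
\<close>

lemma finite_borel_measure_leI_cdf_increments:
  assumes M: "finite_borel_measure M" and N: "finite_borel_measure N"
    and incr: "\<And>s t. s \<le> t \<Longrightarrow> cdf M t - cdf M s \<le> cdf N t - cdf N s"
  shows "M \<le> N"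
proof -
  interpret M: finite_borel_measure M by fact
  interpret N: finite_borel_measure N by fact
  let ?F = "\<lambda>t. cdf N t - cdf M t"
  define R where "R = interval_measure ?F"
  have mono: "?F s \<le> ?F t" if "s \<le> t" for s t
    using incr[OF that] by simp
  have rc: "continuous (at_right a) ?F" for a
    by (intro continuous_intros N.cdf_is_right_cont M.cdf_is_right_cont)
  have bot: "(?F \<longlongrightarrow> 0) at_bot"
    using tendsto_diff[OF N.cdf_lim_at_bot M.cdf_lim_at_bot] by simp
  have top: "(?F \<longlongrightarrow> measure N (space N) - measure M (space M)) at_top"
    by (intro tendsto_diff N.cdf_lim_at_top M.cdf_lim_at_top)
  have "0 \<le> measure N (space N) - measure M (space M)"
  proof (rule tendsto_le[OF _ top bot[THEN filterlim_compose, OF filterlim_uminus_at_bot_at_top]])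
    show "\<forall>\<^sub>F x in at_top. ?F (- x) \<le> ?F x"
      using eventually_ge_at_top[of 0] by eventually_elim (auto intro!: mono)
  qed simp
  then have R: "finite_borel_measure R"
    unfolding R_def by (intro finite_borel_measure_interval_measure[OF mono rc bot top])
  have cR: "cdf R = ?F"
    unfolding R_def by (intro cdf_interval_measure mono rc bot)
  have "N = add_measure M R"
    by (rule cdf_unique'[OF N finite_borel_measure_add_measure[OF M R]])
      (simp add: cdf_add_measure[OF M R] cR fun_eq_iff)
  moreover have "sets M = sets R"
    by (simp add: M.M_is_borel finite_borel_measure.M_is_borel[OF R])
  ultimately show ?thesis
    by (subst le_measure) (auto simp: emeasure_add_measure)
qed

lemma (in finite_borel_measure) cdf_increment_le:
  assumes N: "finite_borel_measure N" and le: "M \<le> N" and "s \<le> t"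
  shows "cdf M t - cdf M s \<le> cdf N t - cdf N s"
proof -
  interpret N: finite_borel_measure N by fact
  have "emeasure M {s<..t} \<le> emeasure N {s<..t}"
    using le by (subst (asm) le_measure) (auto simp: M_is_borel N.M_is_borel)
  then show ?thesis
    using \<open>s \<le> t\<close> N.cdf_nondecreasing[OF \<open>s \<le> t\<close>]
    by (simp add: emeasure_Ioc N.emeasure_Ioc)
qed

lemma (in finite_borel_measure) cdf_Ioi_part:
  "cdf (density M (indicator {x<..})) t = (if t < x then 0 else cdf M t - cdf M x)"
proof -
  have "cdf (density M (indicator {x<..})) t = measure M ({x<..} \<inter> {..t})"
    unfolding cdf_def by (intro measure_restricted) auto
  also have "\<dots> = (if t < x then 0 else cdf M t - cdf M x)"
  proof (cases "t \<le> x")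
    case True
    then have "{x<..} \<inter> {..t} = {}" by auto
    then show ?thesis using True by auto
  next
    case False
    then have "{x<..} \<inter> {..t} = {x<..t}" by auto
    then show ?thesis using False cdf_diff_eq[of x t] by auto
  qed
  finally show ?thesis .
qed

lemma (in finite_borel_measure) finite_borel_measure_Ioi_part:
  "finite_borel_measure (density M (indicator {x<..}))"
proof (intro finite_borel_measure.intro finite_borel_measure_axioms.intro finite_measureI)
  show "emeasure (density M (indicator {x<..})) (space (density M (indicator {x<..}))) \<noteq> \<infinity>"
    by (subst emeasure_restricted) auto
qed (simp add: M_is_borel)

lemma (in finite_borel_measure) measure_Ioi_part_UNIV:
  "measure (density M (indicator {x<..})) UNIV = measure M UNIV - cdf M x"
proof -
  have "measure (density M (indicator {x<..})) UNIV = measure M ({x<..} \<inter> UNIV)"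
    by (intro measure_restricted) auto
  also have "{x<..} \<inter> UNIV = space M - {..x}" by (auto simp: borel_UNIV)
  finally show ?thesis
    by (subst (asm) finite_measure_compl) (auto simp: cdf_def borel_UNIV)
qed

section \<open>The explicit form of the target measures\<close>

locale st_ordered_pair = \<alpha>: finite_borel_measure \<alpha> + \<beta>: finite_borel_measure \<beta> for \<alpha> \<beta> +
  assumes st_le: "\<alpha> \<preceq>\<^sub>s\<^sub>t \<beta>"
begin

definition gap :: "real \<Rightarrow> real"
  where "gap s = cdf \<alpha> s - cdf \<beta> s"

definition least_gap :: "real \<Rightarrow> real \<Rightarrow> real"
  where "least_gap x t = (INF s\<in>{x..t}. gap s)"

text \<open>
  The largest cdf that the two constraints allow: for \<open>\<theta> \<le> \<beta>\<close> that dominates the part of \<open>\<alpha>\<close>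
  above \<open>x\<close>, and for \<open>x \<le> s \<le> t\<close>, one has
  \<open>F\<^sub>\<theta>(t) \<le> F\<^sub>\<theta>(s) + F\<^sub>\<beta>(t) - F\<^sub>\<beta>(s) \<le> F\<^sub>\<beta>(t) - F\<^sub>\<alpha>(x) + gap s\<close>.
\<close>

definition target_cdf :: "real \<Rightarrow> real \<Rightarrow> real"
  where "target_cdf x t = (if t < x then 0 else cdf \<beta> t - cdf \<alpha> x + least_gap x t)"

lemma mass_eq: "measure \<alpha> UNIV = measure \<beta> UNIV"
  using st_le by (simp add: st_le_def)

lemma gap_nonneg: "0 \<le> gap s"
  using st_le by (simp add: st_le_def gap_def)

lemma bdd_below_gap: "bdd_below (gap ` A)"
  using gap_nonneg by (intro bdd_belowI[of _ 0]) auto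

lemma gap_tendsto_at_top: "(gap \<longlongrightarrow> 0) at_top"
  using tendsto_diff[OF \<alpha>.cdf_lim_at_top \<beta>.cdf_lim_at_top] mass_eq
  by (simp add: gap_def[abs_def] \<alpha>.borel_UNIV \<beta>.borel_UNIV)

lemma least_gap_nonneg: "x \<le> t \<Longrightarrow> 0 \<le> least_gap x t"
  unfolding least_gap_def by (intro cINF_greatest gap_nonneg) auto

lemma least_gap_lower: "x \<le> s \<Longrightarrow> s \<le> t \<Longrightarrow> least_gap x t \<le> gap s"
  unfolding least_gap_def by (intro cINF_lower bdd_below_gap) auto

lemma least_gap_same: "least_gap x x = gap x"
  by (simp add: least_gap_def)

lemma least_gap_split:
  assumes "x \<le> t" "t \<le> u"
  shows "least_gap x u = min (least_gap x t) (least_gap t u)"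
proof -
  have "{x..u} = {x..t} \<union> {t..u}" using assms by auto
  then show ?thesis
    unfolding least_gap_def using assms
    by (simp add: cINF_union bdd_below_gap inf_min)
qed

text \<open>
  The gap decreases between two points by at most the mass of \<open>\<beta>\<close> between them. This is what makes
  the target cdf nondecreasing.
\<close>

lemma least_gap_ge:
  assumes "x \<le> t"
  shows "gap x - (cdf \<beta> t - cdf \<beta> x) \<le> least_gap x t"
  unfolding least_gap_def
proof (rule cINF_greatest)
  fix s assume "s \<in> {x..t}"
  then show "gap x - (cdf \<beta> t - cdf \<beta> x) \<le> gap s"
    using \<alpha>.cdf_nondecreasing[of x s] \<beta>.cdf_nondecreasing[of s t] by (simp add: gap_def)
qed (use assms in auto)

lemma target_cdf_self: "target_cdf x x = 0"
  by (simp add: target_cdf_def least_gap_same gap_def)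

text \<open>
  Since the target cdf vanishes at \<open>x\<close>, its increments may be computed after moving all arguments
  below \<open>x\<close> up to \<open>x\<close>. The three lemmas on increments below use this to avoid a case distinction on
  the position of \<open>x\<close>.
\<close>

lemma target_cdf_max: "target_cdf x t = target_cdf x (max x t)"
  by (cases "t < x") (auto simp: target_cdf_self target_cdf_def[of x t] max_def)

lemma target_cdf_increment_nonneg:
  assumes "t \<le> u" shows "0 \<le> target_cdf x u - target_cdf x t"
proof -
  have "0 \<le> target_cdf x u - target_cdf x t" if "x \<le> t" "t \<le> u" for t u
    using least_gap_split[OF that] least_gap_ge[OF that(2)] least_gap_lower[of x t t] that
      \<beta>.cdf_nondecreasing[OF that(2)]
    by (auto simp: target_cdf_def min_def split: if_splits)
  from this[of "max x t" "max x u"] show ?thesis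
    using assms by (simp flip: target_cdf_max)
qed

text \<open>
  The running minimum of the gap only decreases, so the increments of the target cdf are at most
  those of \<open>\<beta>\<close>. Besides giving that the target is a submeasure of \<open>\<beta>\<close>, this makes the target cdf
  inherit its right-continuity from \<open>\<beta>\<close>.
\<close>

lemma target_cdf_increment_le:
  assumes "t \<le> u" shows "target_cdf x u - target_cdf x t \<le> cdf \<beta> u - cdf \<beta> t"
proof -
  have *: "target_cdf x u - target_cdf x t \<le> cdf \<beta> u - cdf \<beta> t" if "x \<le> t" "t \<le> u" for t u
    using least_gap_split[OF that] that by (simp add: target_cdf_def)
  have "target_cdf x u - target_cdf x t \<le> cdf \<beta> (max x u) - cdf \<beta> (max x t)"
    using *[of "max x t" "max x u"] assms by (simp flip: target_cdf_max)
  also have "\<dots> \<le> cdf \<beta> u - cdf \<beta> t"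
    using assms by (auto simp: max_def intro!: \<beta>.cdf_nondecreasing)
  finally show ?thesis .
qed

text \<open>
  A minimum taken over a longer past is already lower, hence it has less left to fall: the running
  minimum started at \<open>x \<le> y\<close> drops between \<open>t\<close> and \<open>u\<close> by no more than the one started at \<open>y\<close>.
\<close>

lemma target_cdf_increment_antimono:
  assumes "x \<le> y" "t \<le> u"
  shows "target_cdf y u - target_cdf y t \<le> target_cdf x u - target_cdf x t"
proof -
  have *: "target_cdf y u - target_cdf y t \<le> target_cdf x u - target_cdf x t"
    if "y \<le> t" "t \<le> u" for t u
    using that least_gap_split[of y t u] least_gap_split[of x y t] least_gap_split[of x y u] \<open>x \<le> y\<close>
    by (auto simp: target_cdf_def min_def split: if_splits)
  have "target_cdf y u - target_cdf y t \<le> target_cdf x (max y u) - target_cdf x (max y t)"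
    using *[of "max y t" "max y u"] assms by (simp flip: target_cdf_max)
  also have "\<dots> \<le> target_cdf x u - target_cdf x t"
    using assms target_cdf_increment_nonneg[of t y x] target_cdf_increment_nonneg[of t u x]
    by (auto simp: max_def)
  finally show ?thesis .
qed

lemma target_cdf_right_cont: "continuous (at_right t) (target_cdf x)"
  unfolding continuous_within
proof (rule tendsto_sandwich)
  show "\<forall>\<^sub>F u in at_right t. target_cdf x t \<le> target_cdf x u"
    using eventually_at_right_less[of t]
    by eventually_elim (use target_cdf_increment_nonneg in \<open>auto simp: less_imp_le\<close>)
  show "\<forall>\<^sub>F u in at_right t. target_cdf x u \<le> target_cdf x t + (cdf \<beta> u - cdf \<beta> t)"
    using eventually_at_right_less[of t]
  proof eventually_elim
    case (elim u)
    then show ?case using target_cdf_increment_le[of t u x] by simp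
  qed
  show "((\<lambda>u. target_cdf x t + (cdf \<beta> u - cdf \<beta> t)) \<longlongrightarrow> target_cdf x t) (at_right t)"
    using \<beta>.cdf_is_right_cont[of t] unfolding continuous_within
    by (auto intro!: tendsto_eq_intros)
qed simp

lemma target_cdf_at_bot: "(target_cdf x \<longlongrightarrow> 0) at_bot"
  by (rule tendsto_eventually)
    (use eventually_at_bot_dense in \<open>auto simp: target_cdf_def intro!: exI[of _ x]\<close>)

lemma target_cdf_at_top: "(target_cdf x \<longlongrightarrow> measure \<alpha> UNIV - cdf \<alpha> x) at_top"
proof -
  have "(least_gap x \<longlongrightarrow> 0) at_top"
  proof (rule tendsto_sandwich[OF _ _ tendsto_const gap_tendsto_at_top])
    show "\<forall>\<^sub>F t in at_top. 0 \<le> least_gap x t"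
      using eventually_ge_at_top[of x] by eventually_elim (rule least_gap_nonneg)
    show "\<forall>\<^sub>F t in at_top. least_gap x t \<le> gap t"
      using eventually_ge_at_top[of x] by eventually_elim (auto intro: least_gap_lower)
  qed
  then have "((\<lambda>t. cdf \<beta> t - cdf \<alpha> x + least_gap x t) \<longlongrightarrow> measure \<alpha> UNIV - cdf \<alpha> x) at_top"
    using \<beta>.cdf_lim_at_top mass_eq
    by (auto intro!: tendsto_eq_intros simp: \<beta>.borel_UNIV)
  then show ?thesis
  proof (rule Lim_transform_eventually)
    show "\<forall>\<^sub>F t in at_top. cdf \<beta> t - cdf \<alpha> x + least_gap x t = target_cdf x t"
      using eventually_ge_at_top[of x] by eventually_elim (simp add: target_cdf_def)
  qed
qed

definition target :: "real \<Rightarrow> real measure"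
  where "target x = interval_measure (target_cdf x)"

lemma cdf_target: "cdf (target x) = target_cdf x"
  unfolding target_def
  by (intro cdf_interval_measure target_cdf_right_cont target_cdf_at_bot)
    (use target_cdf_increment_nonneg in auto)

lemma
  shows finite_borel_measure_target: "finite_borel_measure (target x)"
    and emeasure_target_UNIV: "emeasure (target x) UNIV = ennreal (measure \<alpha> UNIV - cdf \<alpha> x)"
proof -
  have *: "target_cdf x s \<le> target_cdf x t" if "s \<le> t" for s t
    using target_cdf_increment_nonneg[OF that, of x] by simp
  have m: "0 \<le> measure \<alpha> UNIV - cdf \<alpha> x"
    using \<alpha>.cdf_bounded by (simp add: \<alpha>.borel_UNIV)
  note F = * target_cdf_right_cont target_cdf_at_bot target_cdf_at_top m
  show "finite_borel_measure (target x)"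
    unfolding target_def by (rule finite_borel_measure_interval_measure[OF F])
  show "emeasure (target x) UNIV = ennreal (measure \<alpha> UNIV - cdf \<alpha> x)"
    unfolding target_def by (rule interval_measure_UNIV[OF F])
qed

lemma measure_target_UNIV: "measure (target x) UNIV = measure \<alpha> UNIV - cdf \<alpha> x"
  using \<alpha>.cdf_bounded[of x] by (simp add: measure_def[of "target x"] emeasure_target_UNIV \<alpha>.borel_UNIV)

lemma target_le: "target x \<le> \<beta>"
  by (intro finite_borel_measure_leI_cdf_increments finite_borel_measure_target)
    (simp_all add: cdf_target target_cdf_increment_le \<beta>.finite_borel_measure_axioms)

lemma target_antimono: "x \<le> y \<Longrightarrow> target y \<le> target x"
  by (intro finite_borel_measure_leI_cdf_increments finite_borel_measure_target)
    (simp add: cdf_target target_cdf_increment_antimono)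

lemma target_dominating: "target x \<in> dominating_submeasures \<alpha> \<beta> x"
proof -
  have "target_cdf x t \<le> cdf (density \<alpha> (indicator {x<..})) t" for t
    using least_gap_lower[of x t t]
    by (auto simp: \<alpha>.cdf_Ioi_part target_cdf_def gap_def)
  then show ?thesis
    by (simp add: dominating_submeasures_def finite_borel_measure_target target_le st_le_def
      \<alpha>.measure_Ioi_part_UNIV measure_target_UNIV cdf_target)
qed

lemma target_least:
  assumes "\<theta> \<in> dominating_submeasures \<alpha> \<beta> x"
  shows "target x \<preceq>\<^sub>s\<^sub>t \<theta>"
proof -
  from assms interpret \<theta>: finite_borel_measure \<theta> by (simp add: dominating_submeasures_def)
  have le: "\<theta> \<le> \<beta>" and mass: "measure \<theta> UNIV = measure \<alpha> UNIV - cdf \<alpha> x"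
    and dom: "\<And>t. cdf \<theta> t \<le> (if t < x then 0 else cdf \<alpha> t - cdf \<alpha> x)"
    using assms by (auto simp: dominating_submeasures_def st_le_def \<alpha>.cdf_Ioi_part
        \<alpha>.measure_Ioi_part_UNIV)
  have "cdf \<theta> t \<le> target_cdf x t" for t
  proof (cases "t < x")
    case False
    have "cdf \<theta> t - (cdf \<beta> t - cdf \<alpha> x) \<le> least_gap x t"
      unfolding least_gap_def
    proof (rule cINF_greatest)
      fix s assume "s \<in> {x..t}"
      then show "cdf \<theta> t - (cdf \<beta> t - cdf \<alpha> x) \<le> gap s"
        using dom[of s] \<theta>.cdf_increment_le[OF \<beta>.finite_borel_measure_axioms le, of s t]
        by (simp add: gap_def)
    qed (use False in auto)
    then show ?thesis using False by (simp add: target_cdf_def)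
  qed (use dom[of t] in \<open>simp add: target_cdf_def\<close>)
  then show ?thesis
    by (simp add: st_le_def mass measure_target_UNIV cdf_target)
qed

text \<open>
  A least element of the admissible set is its only minimal element, because the stochastic order is
  antisymmetric on finite Borel measures.
\<close>

lemma opt_target_eq: "opt_target \<alpha> \<beta> x = target x"
proof -
  have antisym: "\<theta> = target x"
    if "\<theta> \<in> dominating_submeasures \<alpha> \<beta> x" "\<theta> \<preceq>\<^sub>s\<^sub>t target x" for \<theta>
  proof (rule cdf_unique')
    show "finite_borel_measure \<theta>" using that by (simp add: dominating_submeasures_def)
    show "cdf \<theta> = cdf (target x)"
      using that(2) target_least[OF that(1)] by (auto simp: st_le_def intro!: ext antisym)
  qed (rule finite_borel_measure_target)
  show ?thesis
    unfolding opt_target_def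
  proof (rule the_equality)
    show "target x \<in> dominating_submeasures \<alpha> \<beta> x \<and>
      (\<forall>\<theta>'\<in>dominating_submeasures \<alpha> \<beta> x. \<theta>' \<preceq>\<^sub>s\<^sub>t target x \<longrightarrow> \<theta>' = target x)"
      using target_dominating antisym by blast
  qed (use target_dominating target_least in metis)
qed

end

section \<open>Measures with a prescribed decreasing family of tails\<close>

text \<open>
  The set where the inequality fails carries no mass, as integrating over it would otherwise
  contradict the inequality of the two densities as measures.
\<close>

lemma AE_le_if_density_le:
  assumes [measurable]: "f \<in> borel_measurable M" "g \<in> borel_measurable M"
    and le: "density M f \<le> density M g" and fin: "integral\<^sup>N M g \<noteq> \<infinity>"
  shows "AE x in M. f x \<le> g x"
proof -
  define A where "A = {x \<in> space M. g x < f x}"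
  have [measurable]: "A \<in> sets M" unfolding A_def by measurable
  have "emeasure (density M f) A \<le> emeasure (density M g) A"
    using le by (subst (asm) le_measure) auto
  then have *: "\<not> (\<integral>\<^sup>+x. g x * indicator A x \<partial>M) < (\<integral>\<^sup>+x. f x * indicator A x \<partial>M)"
    by (simp add: emeasure_density not_less)
  have "(\<integral>\<^sup>+x. g x * indicator A x \<partial>M) \<le> integral\<^sup>N M g"
    by (intro nn_integral_mono) (simp add: indicator_def)
  then have fin_A: "(\<integral>\<^sup>+x. g x * indicator A x \<partial>M) \<noteq> \<infinity>"
    using fin by (auto simp: top_unique)
  have "AE x in M. f x * indicator A x \<le> g x * indicator A x"
  proof (rule ccontr)
    assume "\<not> (AE x in M. f x * indicator A x \<le> g x * indicator A x)"
    then have "(\<integral>\<^sup>+x. g x * indicator A x \<partial>M) < (\<integral>\<^sup>+x. f x * indicator A x \<partial>M)"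
      by (intro nn_integral_less fin_A)
        (measurable, auto simp: A_def less_imp_le split: split_indicator)
    with * show False ..
  qed
  then show ?thesis
    using AE_space
    by eventually_elim (auto simp: A_def indicator_def not_less[symmetric] split: if_splits)
qed

lemma emeasure_uniform_unit_interval_less:
  assumes "c \<le> 1"
  shows "emeasure (uniform_measure lborel {0..1::real}) {u. ennreal u < c} = c"
proof -
  from assms obtain r where r: "c = ennreal r" "0 \<le> r" "r \<le> 1"
    by (cases c) (auto simp: top_unique)
  have "{0..1} \<inter> {u. ennreal u < c} = {0..<r}"
    using r by (auto simp: ennreal_less_iff)
  moreover have "{u. ennreal u < c} \<in> sets borel" by measurable
  ultimately have "emeasure (uniform_measure lborel {0..1::real}) {u. ennreal u < c} = ennreal r / 1"
    using r(2) by (simp add: emeasure_uniform_measure)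
  also have "\<dots> = c"
    using divide_ennreal[of r 1] r by simp
  finally show ?thesis .
qed

text \<open>
  The measure is the law of a random pair. Take a point \<open>y\<close> distributed according to \<open>M\<close> and an
  independent uniform level \<open>u\<close> in \<open>[0, 1]\<close>. With \<open>f\<^sub>q\<close> the density of \<open>\<kappa> q\<close> with respect to \<open>M\<close>, let the
  first coordinate be the supremum of all rational \<open>q\<close> with \<open>u < f\<^sub>q(y)\<close>. This is the quantile function
  of the conditional law whose tails at \<open>y\<close> are \<open>q \<mapsto> f\<^sub>q(y)\<close>, and it is measurable as a countable
  supremum, so that no conditional law has to be built.
\<close>

proposition (in finite_measure) exists_measure_with_tail_family:
  fixes \<kappa> :: "real \<Rightarrow> 'a measure"
  assumes sets: "\<And>x. sets (\<kappa> x) = sets M"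
    and le: "\<And>x. \<kappa> x \<le> M"
    and antimono: "\<And>x y. x \<le> y \<Longrightarrow> \<kappa> y \<le> \<kappa> x"
    and right_cont: "\<And>x. continuous (at_right x) (\<lambda>x. measure (\<kappa> x) (space M))"
    and at_top: "((\<lambda>x. measure (\<kappa> x) (space M)) \<longlongrightarrow> 0) at_top"
    and at_bot: "((\<lambda>x. measure (\<kappa> x) (space M)) \<longlongrightarrow> measure M (space M)) at_bot"
  obtains P where "sets P = sets (borel \<Otimes>\<^sub>M M)" "distr P M snd = M"
    "\<And>x B. B \<in> sets M \<Longrightarrow> emeasure P ({x<..} \<times> B) = emeasure (\<kappa> x) B"
proof -
  have le': "emeasure (\<kappa> x) B \<le> emeasure M B" for x B
    using le[of x] sets by (subst (asm) le_measure) (auto simp: emeasure_notin_sets)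
  have antimono': "emeasure (\<kappa> y) B \<le> emeasure (\<kappa> x) B" if "x \<le> y" for x y B
    using antimono[OF that] sets by (subst (asm) le_measure) (auto simp: emeasure_notin_sets)
  have fin\<kappa>: "finite_measure (\<kappa> x)" for x
    using le'[of x "space M"] sets_eq_imp_space_eq[OF sets] emeasure_finite
    by (intro finite_measureI) (auto simp: top_unique)
  define f where "f x = RN_deriv M (\<kappa> x)" for x
  have [measurable]: "f x \<in> borel_measurable M" for x by (simp add: f_def)
  have ac: "absolutely_continuous M (\<kappa> x)" for x
    unfolding absolutely_continuous_def
  proof
    fix B assume B: "B \<in> null_sets M"
    then show "B \<in> null_sets (\<kappa> x)"
      using le'[of x B] by (intro null_setsI) (simp_all add: sets null_setsD1 null_setsD2)
  qed
  have dens: "density M (f x) = \<kappa> x" for x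
    unfolding f_def by (intro density_RN_deriv ac sets)
  have emeasure_\<kappa>: "emeasure (\<kappa> x) B = (\<integral>\<^sup>+y. f x y * indicator B y \<partial>M)" if "B \<in> sets M" for x B
    using that by (subst dens[symmetric]) (simp add: emeasure_density)
  have f_fin: "integral\<^sup>N M (f x) \<noteq> \<infinity>" for x
    using emeasure_\<kappa>[of "space M" x] le'[of x "space M"] emeasure_finite
    by (auto simp: top_unique cong: nn_integral_cong)
  have f_le_1: "AE y in M. f x y \<le> 1" for x
    by (rule AE_le_if_density_le) (auto simp: dens le density_1)
  have f_antimono: "AE y in M. f y' y \<le> f x y" if "x \<le> y'" for x y'
    by (rule AE_le_if_density_le) (use that f_fin antimono in \<open>auto simp: dens\<close>)

  define U where "U = uniform_measure lborel {0..1::real}"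
  interpret U: prob_space U
    unfolding U_def by (rule prob_space_uniform_measure) auto
  have [measurable_cong, simp]: "sets U = sets borel" by (simp add: U_def)
  have [simp]: "space U = UNIV" by (simp add: U_def)
  define \<Omega> where "\<Omega> = M \<Otimes>\<^sub>M U"
  interpret \<Omega>: pair_sigma_finite M U ..
  have sets_\<Omega>[measurable_cong]: "sets \<Omega> = sets (M \<Otimes>\<^sub>M borel)"
    unfolding \<Omega>_def by (intro sets_pair_measure_cong) auto
  have [simp]: "space \<Omega> = space M \<times> UNIV" by (simp add: \<Omega>_def space_pair_measure)
  have em_times: "emeasure \<Omega> (B \<times> UNIV) = emeasure M B" if "B \<in> sets M" for B
    using that U.emeasure_space_1 unfolding \<Omega>_def
    by (subst U.emeasure_pair_measure_Times) auto

  \<comment> \<open>The region below the graph of the density; over \<open>B\<close> it has mass \<open>\<kappa> x B\<close>.\<close>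
  define L where "L x = {\<omega> \<in> space \<Omega>. ennreal (snd \<omega>) < f x (fst \<omega>)}" for x
  have [measurable]: "L x \<in> sets \<Omega>" for x unfolding L_def by measurable
  have em_L: "emeasure \<Omega> (L x \<inter> (B \<times> UNIV)) = emeasure (\<kappa> x) B" if [measurable]: "B \<in> sets M" for x B
  proof -
    have "emeasure \<Omega> (L x \<inter> (B \<times> UNIV)) =
        (\<integral>\<^sup>+y. emeasure U (Pair y -` (L x \<inter> (B \<times> UNIV))) \<partial>M)"
      unfolding \<Omega>_def
    proof (rule U.emeasure_pair_measure_alt)
      show "L x \<inter> (B \<times> UNIV) \<in> Sigma_Algebra.sets (M \<Otimes>\<^sub>M U)"
        unfolding \<Omega>_def[symmetric] by measurable
    qed
    also have "\<dots> = (\<integral>\<^sup>+y. f x y * indicator B y \<partial>M)"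
    proof (rule nn_integral_cong_AE)
      show "AE y in M. emeasure U (Pair y -` (L x \<inter> (B \<times> UNIV))) = f x y * indicator B y"
        using f_le_1[of x] AE_space
      proof eventually_elim
        case (elim y)
        then have "Pair y -` (L x \<inter> (B \<times> UNIV)) = (if y \<in> B then {u. ennreal u < f x y} else {})"
          by (auto simp: L_def)
        then show ?case
          using emeasure_uniform_unit_interval_less[OF elim(1)] by (simp add: U_def)
      qed
    qed
    finally show ?thesis by (simp add: emeasure_\<kappa>)
  qed
  have L_antimono: "AE \<omega> in \<Omega>. \<omega> \<in> L y \<longrightarrow> \<omega> \<in> L x" if "x \<le> y" for x y
    unfolding \<Omega>_def
  proof (rule \<Omega>.AE_pair_measure)
    show "{\<omega> \<in> space (M \<Otimes>\<^sub>M U). \<omega> \<in> L y \<longrightarrow> \<omega> \<in> L x} \<in> sets (M \<Otimes>\<^sub>M U)"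
      unfolding \<Omega>_def[symmetric] by measurable
    show "AE z in M. AE u in U. (z, u) \<in> L y \<longrightarrow> (z, u) \<in> L x"
      using f_antimono[OF that] by eventually_elim (auto simp: L_def)
  qed

  \<comment> \<open>Extended real values, because on a null set the supremum may be infinite or empty.\<close>
  define S :: "'a \<times> real \<Rightarrow> ereal"
    where "S \<omega> = (SUP q\<in>\<rat>. if \<omega> \<in> L q then ereal q else -\<infinity>)" for \<omega>
  have [measurable]: "S \<in> borel_measurable \<Omega>"
    unfolding S_def by (intro borel_measurable_SUP countable_rat) measurable
  have S_gt: "ereal x < S \<omega> \<longleftrightarrow> (\<exists>q\<in>\<rat>. x < q \<and> \<omega> \<in> L q)" for x \<omega>
    unfolding S_def less_SUP_iff by (auto split: if_splits)

  have em_S: "emeasure \<Omega> ({\<omega> \<in> space \<Omega>. ereal x < S \<omega>} \<inter> (B \<times> UNIV)) = emeasure (\<kappa> x) B"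
    if [measurable]: "B \<in> sets M" for x B
  proof (rule antisym)
    have "AE \<omega> in \<Omega>. \<forall>q\<in>\<rat>. x < q \<longrightarrow> \<omega> \<in> L q \<longrightarrow> \<omega> \<in> L x"
      using L_antimono by (subst AE_ball_countable) (auto simp: countable_rat less_imp_le)
    then have "AE \<omega> in \<Omega>. ereal x < S \<omega> \<longrightarrow> \<omega> \<in> L x"
      by eventually_elim (auto simp: S_gt)
    then have "emeasure \<Omega> ({\<omega> \<in> space \<Omega>. ereal x < S \<omega>} \<inter> (B \<times> UNIV)) \<le>
        emeasure \<Omega> (L x \<inter> (B \<times> UNIV))"
      by (intro emeasure_mono_AE) auto
    then show "emeasure \<Omega> ({\<omega> \<in> space \<Omega>. ereal x < S \<omega>} \<inter> (B \<times> UNIV)) \<le> emeasure (\<kappa> x) B"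
      by (simp add: em_L)
  next
    \<comment> \<open>The loss of mass on \<open>B\<close> is at most the loss of total mass, so right-continuity of the
      total mass gives right-continuity on every \<open>B\<close>.\<close>
    have *: "measure (\<kappa> x) B - (measure (\<kappa> x) (space M) - measure (\<kappa> q) (space M))
        \<le> measure (\<kappa> q) B" if "x < q" for q
    proof -
      interpret x: finite_measure "\<kappa> x" by (rule fin\<kappa>)
      interpret q: finite_measure "\<kappa> q" by (rule fin\<kappa>)
      have sp: "space (\<kappa> x) = space M" "space (\<kappa> q) = space M"
        by (simp_all add: sets_eq_imp_space_eq[OF sets])
      have "emeasure (\<kappa> q) (space M - B) \<le> emeasure (\<kappa> x) (space M - B)"
        using \<open>x < q\<close> by (intro antimono') simp
      then have "measure (\<kappa> q) (space M - B) \<le> measure (\<kappa> x) (space M - B)"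
        by (simp add: x.emeasure_eq_measure q.emeasure_eq_measure)
      then show ?thesis
        using x.finite_measure_compl[of B] q.finite_measure_compl[of B] by (simp add: sets sp)
    qed
    define R where "R = measure \<Omega> ({\<omega> \<in> space \<Omega>. ereal x < S \<omega>} \<inter> (B \<times> UNIV))"
    have fin: "emeasure \<Omega> ({\<omega> \<in> space \<Omega>. ereal x < S \<omega>} \<inter> (B \<times> UNIV)) \<noteq> \<infinity>"
    proof -
      have "emeasure \<Omega> ({\<omega> \<in> space \<Omega>. ereal x < S \<omega>} \<inter> (B \<times> UNIV)) \<le> emeasure \<Omega> (B \<times> UNIV)"
        by (intro emeasure_mono) auto
      then show ?thesis using emeasure_finite[of B] by (auto simp: em_times top_unique)
    qed
    have R: "emeasure \<Omega> ({\<omega> \<in> space \<Omega>. ereal x < S \<omega>} \<inter> (B \<times> UNIV)) = ennreal R"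
      using fin unfolding R_def by (intro emeasure_eq_ennreal_measure) auto
    have q_le: "measure (\<kappa> q) B \<le> R" if "x < q" for q
    proof -
      interpret q: finite_measure "\<kappa> q" by (rule fin\<kappa>)
      obtain q' where q': "q' \<in> \<rat>" "x < q'" "q' < q" using Rats_dense_in_real[OF \<open>x < q\<close>] by blast
      interpret q': finite_measure "\<kappa> q'" by (rule fin\<kappa>)
      have "emeasure (\<kappa> q) B \<le> emeasure (\<kappa> q') B"
        using q' by (intro antimono') simp
      also have "\<dots> = emeasure \<Omega> (L q' \<inter> (B \<times> UNIV))"
        by (simp add: em_L)
      also have "\<dots> \<le> ennreal R"
        unfolding R[symmetric]
      proof (rule emeasure_mono)
        show "L q' \<inter> B \<times> UNIV \<subseteq> {\<omega> \<in> space \<Omega>. ereal x < S \<omega>} \<inter> B \<times> UNIV"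
          using q' by (auto simp: S_gt L_def)
      qed measurable
      finally show ?thesis
        by (simp add: q.emeasure_eq_measure R_def)
    qed
    have "measure (\<kappa> x) B - (measure (\<kappa> x) (space M) - measure (\<kappa> x) (space M)) \<le> R"
    proof (rule tendsto_upperbound)
      show "((\<lambda>q. measure (\<kappa> x) B - (measure (\<kappa> x) (space M) - measure (\<kappa> q) (space M))) \<longlongrightarrow>
        measure (\<kappa> x) B - (measure (\<kappa> x) (space M) - measure (\<kappa> x) (space M))) (at_right x)"
        using right_cont[of x] unfolding continuous_within by (intro tendsto_intros)
      show "\<forall>\<^sub>F q in at_right x. measure (\<kappa> x) B - (measure (\<kappa> x) (space M) - measure (\<kappa> q) (space M)) \<le> R"
        using eventually_at_right_less[of x] by eventually_elim (rule order_trans[OF * q_le])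
    qed simp
    then show "emeasure (\<kappa> x) B \<le> emeasure \<Omega> ({\<omega> \<in> space \<Omega>. ereal x < S \<omega>} \<inter> (B \<times> UNIV))"
      unfolding R using finite_measure.emeasure_eq_measure[OF fin\<kappa>] by (simp add: R_def)
  qed

  have em_S_space: "emeasure \<Omega> {\<omega> \<in> space \<Omega>. ereal x < S \<omega>} = ennreal (measure (\<kappa> x) (space M))" for x
  proof -
    have "{\<omega> \<in> space \<Omega>. ereal x < S \<omega>} \<inter> (space M \<times> UNIV) = {\<omega> \<in> space \<Omega>. ereal x < S \<omega>}" by auto
    then show ?thesis using em_S[of "space M" x] finite_measure.emeasure_eq_measure[OF fin\<kappa>] by simp
  qed
  interpret \<Omega>': finite_measure \<Omega>
    by (rule finite_measureI) (use em_times[of "space M"] emeasure_finite in simp)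
  have mS: "measure \<Omega> {\<omega> \<in> space \<Omega>. ereal x < S \<omega>} = measure (\<kappa> x) (space M)" for x
    using em_S_space[of x] by (simp add: measure_def)
  have m\<Omega>: "measure \<Omega> (space \<Omega>) = measure M (space M)"
    using em_times[of "space M"] by (simp add: measure_def)
  have "AE \<omega> in \<Omega>. S \<omega> \<noteq> \<infinity>"
  proof (rule AE_I)
    show "{\<omega> \<in> space \<Omega>. \<not> S \<omega> \<noteq> \<infinity>} \<subseteq> {\<omega> \<in> space \<Omega>. S \<omega> = \<infinity>}" by auto
    have "measure \<Omega> {\<omega> \<in> space \<Omega>. S \<omega> = \<infinity>} \<le> 0"
    proof (rule tendsto_lowerbound[OF at_top])
      show "\<forall>\<^sub>F x in at_top. measure \<Omega> {\<omega> \<in> space \<Omega>. S \<omega> = \<infinity>} \<le> measure (\<kappa> x) (space M)"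
        unfolding mS[symmetric] by (intro always_eventually allI \<Omega>'.finite_measure_mono) auto
    qed simp
    then show "emeasure \<Omega> {\<omega> \<in> space \<Omega>. S \<omega> = \<infinity>} = 0"
      by (simp add: \<Omega>'.emeasure_eq_measure measure_le_0_iff)
  qed measurable
  moreover have "AE \<omega> in \<Omega>. S \<omega> \<noteq> -\<infinity>"
  proof (rule AE_I)
    show "{\<omega> \<in> space \<Omega>. \<not> S \<omega> \<noteq> -\<infinity>} \<subseteq> {\<omega> \<in> space \<Omega>. S \<omega> = -\<infinity>}" by auto
    have "measure \<Omega> {\<omega> \<in> space \<Omega>. S \<omega> = -\<infinity>} \<le> measure M (space M) - measure M (space M)"
    proof (rule tendsto_lowerbound)
      show "((\<lambda>x. measure M (space M) - measure (\<kappa> x) (space M)) \<longlongrightarrow>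
        measure M (space M) - measure M (space M)) at_bot"
        by (intro tendsto_intros at_bot)
      have "measure \<Omega> {\<omega> \<in> space \<Omega>. S \<omega> = -\<infinity>} \<le> measure M (space M) - measure (\<kappa> x) (space M)" for x
        unfolding mS[symmetric] m\<Omega>[symmetric]
        by (subst \<Omega>'.finite_measure_compl[symmetric])
          (auto intro!: \<Omega>'.finite_measure_mono)
      then show "\<forall>\<^sub>F x in at_bot. measure \<Omega> {\<omega> \<in> space \<Omega>. S \<omega> = -\<infinity>} \<le>
        measure M (space M) - measure (\<kappa> x) (space M)"
        by simp
    qed simp
    then show "emeasure \<Omega> {\<omega> \<in> space \<Omega>. S \<omega> = -\<infinity>} = 0"
      by (simp add: \<Omega>'.emeasure_eq_measure measure_le_0_iff)
  qed measurable
  ultimately have S_fin: "AE \<omega> in \<Omega>. S \<omega> = ereal (real_of_ereal (S \<omega>))"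
    by eventually_elim (auto simp: ereal_real)

  define X where "X \<omega> = (real_of_ereal (S \<omega>), fst \<omega>)" for \<omega>
  have fst_\<Omega>[measurable]: "fst \<in> \<Omega> \<rightarrow>\<^sub>M M" by (simp add: \<Omega>_def)
  have X[measurable]: "X \<in> \<Omega> \<rightarrow>\<^sub>M borel \<Otimes>\<^sub>M M" unfolding X_def by measurable
  show ?thesis
  proof
    show "sets (distr \<Omega> (borel \<Otimes>\<^sub>M M) X) = sets (borel \<Otimes>\<^sub>M M)" by simp
    have "distr (distr \<Omega> (borel \<Otimes>\<^sub>M M) X) M snd = distr \<Omega> M fst"
      by (subst distr_distr) (auto simp: X_def comp_def)
    also have "\<dots> = M"
    proof (rule measure_eqI)
      fix B assume "B \<in> sets (distr \<Omega> M fst)"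
      then have B: "B \<in> sets M" by simp
      then have "fst -` B \<inter> space \<Omega> = B \<times> UNIV" using sets.sets_into_space[OF B] by auto
      then show "emeasure (distr \<Omega> M fst) B = emeasure M B"
        using B by (simp add: emeasure_distr em_times)
    qed simp
    finally show "distr (distr \<Omega> (borel \<Otimes>\<^sub>M M) X) M snd = M" .
    fix x B assume [measurable]: "B \<in> sets M"
    have "emeasure (distr \<Omega> (borel \<Otimes>\<^sub>M M) X) ({x<..} \<times> B) = emeasure \<Omega> (X -` ({x<..} \<times> B) \<inter> space \<Omega>)"
      by (intro emeasure_distr) auto
    also have "\<dots> = emeasure \<Omega> ({\<omega> \<in> space \<Omega>. ereal x < S \<omega>} \<inter> (B \<times> UNIV))"
    proof (rule emeasure_eq_AE)
      show "AE \<omega> in \<Omega>. \<omega> \<in> X -` ({x<..} \<times> B) \<inter> space \<Omega> \<longleftrightarrow>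
          \<omega> \<in> {\<omega> \<in> space \<Omega>. ereal x < S \<omega>} \<inter> (B \<times> UNIV)"
        using S_fin
      proof eventually_elim
        case (elim \<omega>)
        have "x < real_of_ereal (S \<omega>) \<longleftrightarrow> ereal x < S \<omega>" by (subst elim) simp
        then show ?case by (cases \<omega>) (auto simp: X_def)
      qed
    qed (auto intro!: measurable_sets[OF X])
    also have "\<dots> = emeasure (\<kappa> x) B"
      by (rule em_S) fact
    finally show "emeasure (distr \<Omega> (borel \<Otimes>\<^sub>M M) X) ({x<..} \<times> B) = emeasure (\<kappa> x) B" .
  qed
qed

section \<open>Existence and uniqueness of the optimal directional coupling\<close>

text \<open>
  The property that describes the optimal directional coupling, as a predicate, so that a candidate
  can be exhibited and verified before it is known to be the only one.
\<close>

definition is_opt_directional_coupling ::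
    "real measure \<Rightarrow> real measure \<Rightarrow> (real \<times> real) measure \<Rightarrow> bool"
  where "is_opt_directional_coupling \<alpha> \<beta> P \<longleftrightarrow> directional_coupling \<alpha> \<beta> P \<and>
    (\<forall>x. \<forall>B \<in> sets borel. emeasure P ({x<..} \<times> B) = emeasure (opt_target \<alpha> \<beta> x) B)"

lemma UN_Ioi_eq_UNIV: "(\<Union>n. {- real n<..}) = UNIV"
proof -
  have "\<exists>n. - real n < x" for x
    using reals_Archimedean2[of "- x"] by (simp add: minus_less_iff)
  then show ?thesis by auto
qed

lemma borel_prod_Ioi_times:
  "sets (borel :: (real \<times> 'b::second_countable_topology) measure) =
    sigma_sets UNIV {{x<..} \<times> B | x B. B \<in> sets borel}"
proof -
  let ?E = "{a \<times> b | a b. a \<in> range (\<lambda>x::real. {x<..}) \<and> b \<in> sets (borel :: 'b measure)}"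
  have "sets (borel :: (real \<times> 'b) measure) = sets (borel \<Otimes>\<^sub>M borel)"
    by (simp only: borel_prod)
  also have "\<dots> = sets (sigma UNIV (range (\<lambda>x::real. {x<..})) \<Otimes>\<^sub>M sigma (UNIV :: 'b set) (sets borel))"
  proof (rule sets_pair_measure_cong)
    show "sets borel = sets (sigma UNIV (range (\<lambda>x::real. {x<..})))"
      by (simp only: borel_Ioi)
    show "sets (borel :: 'b measure) = sets (sigma UNIV (sets borel))"
      using sets.sigma_sets_eq[of "borel :: 'b measure"] by (simp add: sets_measure_of)
  qed
  also have "sigma UNIV (range (\<lambda>x::real. {x<..})) \<Otimes>\<^sub>M sigma (UNIV :: 'b set) (sets borel) =
      sigma (UNIV \<times> UNIV) ?E"
  proof (rule sigma_prod)
    show "\<exists>E\<subseteq>range (\<lambda>x::real. {x<..}). countable E \<and> UNIV = \<Union>E"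
      by (rule exI[of _ "range (\<lambda>n::nat. {- real n<..})"])
        (simp add: UN_Ioi_eq_UNIV image_subset_iff)
    show "\<exists>E\<subseteq>sets (borel :: 'b measure). countable E \<and> UNIV = \<Union>E"
      by (rule exI[of _ "{UNIV}"]) auto
  qed auto
  also have "sets (sigma (UNIV \<times> UNIV) ?E) = sigma_sets UNIV ?E"
    by simp
  also have "?E = {{x<..} \<times> B | x B. B \<in> sets borel}"
    by auto
  finally show ?thesis .
qed

lemma measure_eqI_Ioi_times:
  fixes P Q :: "(real \<times> real) measure"
  assumes P: "sets P = sets borel" and Q: "sets Q = sets borel" and "finite_measure P"
    and eq: "\<And>x B. B \<in> sets borel \<Longrightarrow> emeasure P ({x<..} \<times> B) = emeasure Q ({x<..} \<times> B)"
  shows "P = Q"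
proof (rule measure_eqI_generator_eq[where \<Omega> = UNIV and
      E = "{{x<..} \<times> B | x B. B \<in> sets borel}" and A = "\<lambda>n. {- real n<..} \<times> UNIV"])
  show "Int_stable {{x::real<..} \<times> B | x B. B \<in> sets (borel::real measure)}"
  proof (rule Int_stableI, clarify)
    fix x B y C assume "B \<in> sets (borel::real measure)" "C \<in> sets (borel::real measure)"
    then show "\<exists>z D. ({x::real<..} \<times> B) \<inter> ({y<..} \<times> C) = {z<..} \<times> D \<and> D \<in> sets borel"
      by (intro exI[of _ "max x y"] exI[of _ "B \<inter> C"]) auto
  qed
  show "(\<Union>n. {- real n<..} \<times> (UNIV :: real set)) = UNIV"
    using UN_Ioi_eq_UNIV by (auto simp: set_eq_iff)
  show "emeasure P ({- real n<..} \<times> UNIV) \<noteq> \<infinity>" for n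
    using assms(3) by (simp add: finite_measure.emeasure_finite)
  show "sets P = sigma_sets UNIV {{x<..} \<times> B | x B. B \<in> sets borel}"
    "sets Q = sigma_sets UNIV {{x<..} \<times> B | x B. B \<in> sets borel}"
    by (simp_all only: P Q borel_prod_Ioi_times)
  have "{- real n<..} \<times> UNIV \<in> {{x::real<..} \<times> B | x B. B \<in> sets (borel :: real measure)}" for n
    by (intro CollectI exI[of _ "- real n"] exI[of _ UNIV]) simp
  then show "range (\<lambda>n. {- real n<..} \<times> UNIV) \<subseteq> {{x<..} \<times> B | x B. B \<in> sets (borel :: real measure)}"
    by blast
qed (auto simp: eq)

lemma borel_measurable_fst: "fst \<in> borel_measurable (borel :: (real \<times> real) measure)"
  and borel_measurable_snd: "snd \<in> borel_measurable (borel :: (real \<times> real) measure)"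
  by (intro borel_measurable_continuous_onI continuous_intros)+

text \<open>
  Two optimal couplings agree on all sets \<open>(x, \<infinity>) \<times> B\<close>, which form a generator of the Borel sets of
  the plane that is stable under intersection.
\<close>

lemma opt_directional_coupling_eqI:
  assumes P: "is_opt_directional_coupling \<alpha> \<beta> P" and "finite_measure \<alpha>"
  shows "opt_directional_coupling \<alpha> \<beta> = P"
  unfolding opt_directional_coupling_def is_opt_directional_coupling_def[symmetric]
proof (rule the_equality, rule P)
  have sets_P: "sets P = sets borel"
    using P by (simp add: is_opt_directional_coupling_def directional_coupling_def)
  have fin: "finite_measure P"
  proof (rule finite_measureI)
    have [simp]: "space P = UNIV"
      using sets_eq_imp_space_eq[OF sets_P] by simp
    have "emeasure P (space P) = emeasure (distr P borel fst) UNIV"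
      by (subst emeasure_distr)
        (simp_all add: measurable_cong_sets[OF sets_P refl] borel_measurable_fst)
    also have "distr P borel fst = \<alpha>"
      using P by (simp add: is_opt_directional_coupling_def directional_coupling_def)
    finally show "emeasure P (space P) \<noteq> \<infinity>"
      using assms(2) by (simp add: finite_measure.emeasure_finite)
  qed
  fix Q assume "is_opt_directional_coupling \<alpha> \<beta> Q"
  with P fin have "P = Q"
    by (intro measure_eqI_Ioi_times)
      (simp_all add: is_opt_directional_coupling_def directional_coupling_def)
  then show "Q = P" ..
qed

text \<open>
  The targets are the tails of a measure with second marginal \<open>\<beta>\<close>. Its first marginal is \<open>\<alpha>\<close> because
  the target at \<open>x\<close> has the mass of \<open>\<alpha>\<close> above \<open>x\<close>. It is directional because the target at \<open>x\<close> does
  not charge \<open>(-\<infinity>, x]\<close>.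
\<close>

lemma (in st_ordered_pair) exists_opt_directional_coupling:
  obtains P where "is_opt_directional_coupling \<alpha> \<beta> P"
proof -
  have sets_target: "sets (target x) = sets \<beta>" for x
    by (simp add: target_def \<beta>.M_is_borel)
  have mass: "measure (target x) (space \<beta>) = measure \<alpha> UNIV - cdf \<alpha> x" for x
    by (simp add: \<beta>.borel_UNIV measure_target_UNIV)
  obtain P where P: "sets P = sets (borel \<Otimes>\<^sub>M \<beta>)" "distr P \<beta> snd = \<beta>"
    and tail: "\<And>x B. B \<in> sets \<beta> \<Longrightarrow> emeasure P ({x<..} \<times> B) = emeasure (target x) B"
  proof (rule \<beta>.exists_measure_with_tail_family[OF sets_target target_le target_antimono])
    show "continuous (at_right x) (\<lambda>x. measure (target x) (space \<beta>))" for x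
      unfolding mass by (intro continuous_intros \<alpha>.cdf_is_right_cont)
    show "((\<lambda>x. measure (target x) (space \<beta>)) \<longlongrightarrow> 0) at_top"
      unfolding mass using \<alpha>.cdf_lim_at_top by (auto intro!: tendsto_eq_intros simp: \<alpha>.borel_UNIV)
    show "((\<lambda>x. measure (target x) (space \<beta>)) \<longlongrightarrow> measure \<beta> (space \<beta>)) at_bot"
      unfolding mass using \<alpha>.cdf_lim_at_bot
      by (auto intro!: tendsto_eq_intros simp: \<beta>.borel_UNIV mass_eq)
    fix P assume "sets P = sets (borel \<Otimes>\<^sub>M \<beta>)" "distr P \<beta> snd = \<beta>"
      "\<And>x B. B \<in> sets \<beta> \<Longrightarrow> emeasure P ({x<..} \<times> B) = emeasure (target x) B"
    then show thesis by (rule that)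
  qed
  have "sets P = sets (borel \<Otimes>\<^sub>M borel)"
    unfolding P(1) by (intro sets_pair_measure_cong refl \<beta>.M_is_borel)
  then have sets_P: "sets P = sets borel"
    by (simp only: borel_prod)
  have measurable_P [simp]: "fst \<in> borel_measurable P" "snd \<in> borel_measurable P"
    by (simp_all add: measurable_cong_sets[OF sets_P refl] borel_measurable_fst borel_measurable_snd)
  have [simp]: "space P = UNIV"
    using sets_eq_imp_space_eq[OF sets_P] by simp
  have snd_marginal: "distr P borel snd = \<beta>"
    using P(2) by (subst (asm) distr_cong[OF refl \<beta>.M_is_borel refl])
  have P_UNIV: "emeasure P UNIV = emeasure \<alpha> UNIV"
  proof -
    have "emeasure P UNIV = emeasure (distr P borel snd) UNIV"
      by (subst emeasure_distr) auto
    then show ?thesis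
      using mass_eq \<alpha>.emeasure_eq_measure[of UNIV] \<beta>.emeasure_eq_measure[of UNIV]
      by (simp add: snd_marginal)
  qed
  interpret P: finite_measure P
    by (rule finite_measureI) (simp add: P_UNIV)
  have tail_mass: "measure P ({x<..} \<times> UNIV) = measure \<alpha> UNIV - cdf \<alpha> x" for x
    using tail[of UNIV x] by (simp add: \<beta>.M_is_borel measure_def[of P] flip: measure_target_UNIV measure_def)
  have fst_marginal: "distr P borel fst = \<alpha>"
  proof (rule cdf_unique')
    show "finite_borel_measure (distr P borel fst)"
      by (intro finite_borel_measure.intro finite_borel_measure_axioms.intro P.finite_measure_distr)
        simp_all
    show "cdf (distr P borel fst) = cdf \<alpha>"
    proof
      fix t
      have "cdf (distr P borel fst) t = measure P (space P - {t<..} \<times> UNIV)"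
        unfolding cdf_def by (subst measure_distr) (auto intro!: arg_cong[where f = "measure P"])
      also have "\<dots> = measure P UNIV - measure P ({t<..} \<times> UNIV)"
        by (subst P.finite_measure_compl) (auto simp: sets_P intro!: borel_open open_Times)
      also have "\<dots> = cdf \<alpha> t"
        by (simp add: tail_mass) (simp add: measure_def P_UNIV)
      finally show "cdf (distr P borel fst) t = cdf \<alpha> t" .
    qed
  qed (rule \<alpha>.finite_borel_measure_axioms)
  \<comment> \<open>A point with \<open>y < x\<close> is separated by a rational: it lies in one of countably many null
    quadrants.\<close>
  have "AE p in P. \<forall>q\<in>\<rat>. p \<notin> {q<..} \<times> {..q}"
  proof (subst AE_ball_countable[OF countable_rat], rule ballI)
    fix q :: real
    interpret target: finite_borel_measure "target q" by (rule finite_borel_measure_target)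
    have "emeasure P ({q<..} \<times> {..q}) = ennreal (cdf (target q) q)"
      by (simp add: tail \<beta>.M_is_borel target.emeasure_eq_measure cdf_def)
    also have "\<dots> = 0"
      by (simp add: cdf_target target_cdf_self)
    finally have "{q<..} \<times> {..q} \<in> null_sets P"
      by (intro null_setsI) (auto simp: sets_P simp flip: borel_prod)
    then show "AE p in P. p \<notin> {q<..} \<times> {..q}"
      by (rule AE_not_in)
  qed
  then have "AE p in P. case p of (x, y) \<Rightarrow> x \<le> y"
  proof eventually_elim
    case (elim p)
    show ?case
    proof (rule ccontr)
      assume "\<not> ?thesis"
      then obtain q where "q \<in> \<rat>" "snd p < q" "q < fst p"
        using Rats_dense_in_real[of "snd p" "fst p"] by (auto simp: split_beta)
      then show False
        using elim by (cases p) force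
    qed
  qed
  then have "is_opt_directional_coupling \<alpha> \<beta> P"
    unfolding is_opt_directional_coupling_def directional_coupling_def opt_target_eq
    using sets_P fst_marginal snd_marginal tail by (simp add: \<beta>.M_is_borel)
  then show ?thesis ..
qed

section \<open>Splitting off a common part\<close>

lemma common_part_le:
  assumes "finite_measure \<mu>" "finite_measure \<nu>" and sets: "sets \<mu> = sets \<nu>"
  shows "common_part \<mu> \<nu> \<le> \<mu>" "common_part \<mu> \<nu> \<le> \<nu>"
proof -
  interpret \<mu>: finite_measure \<mu> by fact
  interpret \<nu>: finite_measure \<nu> by fact
  define S where "S = add_measure \<mu> \<nu>"
  have em: "emeasure S A = emeasure \<mu> A + emeasure \<nu> A" for A
    unfolding S_def by (cases "A \<in> Sigma_Algebra.sets \<mu>")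
      (simp_all add: emeasure_add_measure sets emeasure_notin_sets)
  have sets_S: "Sigma_Algebra.sets S = Sigma_Algebra.sets \<mu>" by (simp add: S_def)
  interpret S: finite_measure S
    by (rule finite_measureI) (simp add: em)
  have ac: "absolutely_continuous S \<mu>" "absolutely_continuous S \<nu>"
    by (auto simp: absolutely_continuous_def null_sets_def em sets_S sets)
  have dens: "density S (RN_deriv S \<mu>) = \<mu>" "density S (RN_deriv S \<nu>) = \<nu>"
    by (rule S.density_RN_deriv, rule ac, simp only: sets_S sets)+
  have mono: "density S f \<le> density S g"
    if "f \<in> borel_measurable S" "g \<in> borel_measurable S" "\<And>x. f x \<le> g x" for f g
    using that
    by (subst le_measure) (simp_all add: emeasure_density nn_integral_mono mult_right_mono)
  let ?m = "\<lambda>x. min (RN_deriv S \<mu> x) (RN_deriv S \<nu> x)"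
  have "density S ?m \<le> density S (RN_deriv S \<mu>)" "density S ?m \<le> density S (RN_deriv S \<nu>)"
    by (rule mono; simp)+
  then show "common_part \<mu> \<nu> \<le> \<mu>" "common_part \<mu> \<nu> \<le> \<nu>"
    unfolding common_part_def S_def[symmetric] by (simp_all only: dens)
qed

lemma (in finite_borel_measure) finite_borel_measure_le:
  assumes "\<theta> \<le> M" "sets \<theta> = sets borel"
  shows "finite_borel_measure \<theta>"
proof (intro finite_borel_measure.intro finite_borel_measure_axioms.intro finite_measureI)
  have "emeasure \<theta> (space \<theta>) \<le> emeasure M (space \<theta>)"
    using assms by (subst (asm) le_measure) (auto simp: M_is_borel)
  then show "emeasure \<theta> (space \<theta>) \<noteq> \<infinity>"
    by (auto simp: top_unique)
qed fact

lemma distr_add_Id_coupling: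
  fixes p :: "real \<times> real \<Rightarrow> real"
  assumes p: "p \<in> borel_measurable borel" "\<And>x. p (x, x) = x"
    and \<theta>: "sets \<theta> = sets borel" and P: "sets P = sets borel"
  shows "distr (add_measure (Id_coupling \<theta>) P) borel p = add_measure \<theta> (distr P borel p)"
proof (rule measure_eqI)
  fix A assume "A \<in> sets (distr (add_measure (Id_coupling \<theta>) P) borel p)"
  then have A: "A \<in> sets borel" by simp
  have sets_Id: "sets (Id_coupling \<theta>) = sets borel" by (simp add: Id_coupling_def)
  have [simp]: "space \<theta> = UNIV" "space P = UNIV" "space (Id_coupling \<theta>) = UNIV"
    using \<theta> P sets_Id by (auto dest: sets_eq_imp_space_eq)
  have sets_S: "sets (add_measure (Id_coupling \<theta>) P) = sets borel" by (simp add: sets_Id)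
  have diag: "(\<lambda>x. (x, x)) \<in> \<theta> \<rightarrow>\<^sub>M (borel :: (real \<times> real) measure)"
    unfolding measurable_cong_sets[OF \<theta> refl]
    by (intro borel_measurable_continuous_onI continuous_intros)
  have pA: "p -` A \<in> sets borel" using measurable_sets[OF p(1) A] by simp
  have "emeasure (distr (add_measure (Id_coupling \<theta>) P) borel p) A =
      emeasure (Id_coupling \<theta>) (p -` A) + emeasure P (p -` A)"
    using A pA p(1) by (subst emeasure_distr)
      (simp_all add: measurable_cong_sets[OF sets_S refl] emeasure_add_measure sets_Id P)
  also have "emeasure (Id_coupling \<theta>) (p -` A) = emeasure \<theta> A"
    unfolding Id_coupling_def using pA p(2)
    by (subst emeasure_distr[OF diag]) (simp_all add: vimage_def)
  also have "emeasure P (p -` A) = emeasure (distr P borel p) A"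
    using A p(1) by (subst emeasure_distr) (simp_all add: measurable_cong_sets[OF P refl])
  finally show "emeasure (distr (add_measure (Id_coupling \<theta>) P) borel p) A =
      emeasure (add_measure \<theta> (distr P borel p)) A"
    using A \<theta> by (simp add: emeasure_add_measure)
qed (simp add: \<theta>)

context st_ordered_pair begin

text \<open>
  Removing the same measure from both sides changes neither the difference of the cdfs nor, therefore,
  the stochastic order.
\<close>

lemma st_ordered_pair_diff_measure:
  assumes le: "\<theta> \<le> \<alpha>" "\<theta> \<le> \<beta>" and \<theta>: "sets \<theta> = sets borel"
  shows "st_ordered_pair (diff_measure \<alpha> \<theta>) (diff_measure \<beta> \<theta>)"
    and "cdf (diff_measure \<alpha> \<theta>) t = cdf \<alpha> t - cdf \<theta> t"
    and "cdf (diff_measure \<beta> \<theta>) t = cdf \<beta> t - cdf \<theta> t"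
proof -
  interpret \<theta>: finite_borel_measure \<theta>
    by (rule \<alpha>.finite_borel_measure_le) fact+
  have fin: "finite_borel_measure (diff_measure \<alpha> \<theta>)" "finite_borel_measure (diff_measure \<beta> \<theta>)"
    by (intro finite_borel_measure_diff_measure le \<alpha>.finite_borel_measure_axioms
      \<beta>.finite_borel_measure_axioms \<theta>.finite_borel_measure_axioms)+
  have sum: "add_measure \<theta> (diff_measure \<alpha> \<theta>) = \<alpha>" "add_measure \<theta> (diff_measure \<beta> \<theta>) = \<beta>"
    by (intro add_measure_diff_measure le \<alpha>.finite_measure_axioms \<beta>.finite_measure_axioms
      \<theta>.finite_measure_axioms; simp add: \<theta> \<alpha>.M_is_borel \<beta>.M_is_borel)+
  show cdf: "cdf (diff_measure \<alpha> \<theta>) t = cdf \<alpha> t - cdf \<theta> t"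
    "cdf (diff_measure \<beta> \<theta>) t = cdf \<beta> t - cdf \<theta> t" for t
    using cdf_add_measure[OF \<theta>.finite_borel_measure_axioms fin(1), of t]
      cdf_add_measure[OF \<theta>.finite_borel_measure_axioms fin(2), of t] by (simp_all add: sum)
  interpret \<alpha>': finite_borel_measure "diff_measure \<alpha> \<theta>" by (rule fin)
  interpret \<beta>': finite_borel_measure "diff_measure \<beta> \<theta>" by (rule fin)
  \<comment> \<open>Equality of the total masses is read off from the unchanged limit of the gap.\<close>
  have "((\<lambda>t. cdf (diff_measure \<alpha> \<theta>) t - cdf (diff_measure \<beta> \<theta>) t) \<longlongrightarrow> 0) at_top"
    using gap_tendsto_at_top by (simp add: cdf gap_def[abs_def])
  moreover have "((\<lambda>t. cdf (diff_measure \<alpha> \<theta>) t - cdf (diff_measure \<beta> \<theta>) t) \<longlongrightarrow>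
      measure (diff_measure \<alpha> \<theta>) UNIV - measure (diff_measure \<beta> \<theta>) UNIV) at_top"
    using tendsto_diff[OF \<alpha>'.cdf_lim_at_top \<beta>'.cdf_lim_at_top]
    by (simp add: \<alpha>.borel_UNIV \<beta>.borel_UNIV)
  ultimately have "measure (diff_measure \<alpha> \<theta>) UNIV - measure (diff_measure \<beta> \<theta>) UNIV = 0"
    using tendsto_unique[OF trivial_limit_at_top_linorder] by blast
  then show "st_ordered_pair (diff_measure \<alpha> \<theta>) (diff_measure \<beta> \<theta>)"
    using gap_nonneg by unfold_locales (simp add: st_le_def cdf gap_def)
qed

text \<open>
  In the formula for the target cdf the infimum of the gap is the same for both pairs, so the
  two cdfs differ for \<open>t \<ge> x\<close> by \<open>F\<^sub>\<theta>(t) - F\<^sub>\<theta>(x)\<close>, the cdf of \<open>\<theta>\<close> restricted to \<open>(x, \<infinity>)\<close>.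
\<close>

lemma opt_target_add_common:
  assumes le: "\<theta> \<le> \<alpha>" "\<theta> \<le> \<beta>" and \<theta>: "sets \<theta> = sets borel"
  shows "opt_target \<alpha> \<beta> x =
    add_measure (density \<theta> (indicator {x<..})) (opt_target (diff_measure \<alpha> \<theta>) (diff_measure \<beta> \<theta>) x)"
proof -
  interpret \<theta>: finite_borel_measure \<theta>
    by (rule \<alpha>.finite_borel_measure_le) fact+
  interpret R: st_ordered_pair "diff_measure \<alpha> \<theta>" "diff_measure \<beta> \<theta>"
    by (rule st_ordered_pair_diff_measure) fact+
  note cdf = st_ordered_pair_diff_measure(2,3)[OF assms]
  have gap: "R.gap = gap"
    by (simp add: fun_eq_iff R.gap_def gap_def cdf)
  have "target x = add_measure (density \<theta> (indicator {x<..})) (R.target x)"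
  proof (rule cdf_unique')
    show "finite_borel_measure (add_measure (density \<theta> (indicator {x<..})) (R.target x))"
      by (intro finite_borel_measure_add_measure \<theta>.finite_borel_measure_Ioi_part
        R.finite_borel_measure_target)
    show "cdf (target x) = cdf (add_measure (density \<theta> (indicator {x<..})) (R.target x))"
      by (rule ext)
        (simp add: cdf_add_measure \<theta>.finite_borel_measure_Ioi_part R.finite_borel_measure_target
         \<theta>.cdf_Ioi_part cdf_target R.cdf_target target_cdf_def R.target_cdf_def gap cdf
         least_gap_def R.least_gap_def)
  qed (rule finite_borel_measure_target)
  then show ?thesis
    by (simp add: opt_target_eq R.opt_target_eq)
qed

text \<open>
  The identical coupling lives on the diagonal and sends the restriction of \<open>\<theta>\<close> to \<open>(x, \<infinity>)\<close> to
  itself. By the previous lemma this is precisely the difference of the two targets at \<open>x\<close>.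
\<close>

lemma is_opt_directional_coupling_add_common:
  assumes le: "\<theta> \<le> \<alpha>" "\<theta> \<le> \<beta>" and \<theta>: "sets \<theta> = sets borel"
    and P: "is_opt_directional_coupling (diff_measure \<alpha> \<theta>) (diff_measure \<beta> \<theta>) P"
  shows "is_opt_directional_coupling \<alpha> \<beta> (add_measure (Id_coupling \<theta>) P)"
proof -
  interpret \<theta>: finite_borel_measure \<theta>
    by (rule \<alpha>.finite_borel_measure_le) fact+
  interpret R: st_ordered_pair "diff_measure \<alpha> \<theta>" "diff_measure \<beta> \<theta>"
    by (rule st_ordered_pair_diff_measure) fact+
  have sets_P: "sets P = sets borel"
    and marginals: "distr P borel fst = diff_measure \<alpha> \<theta>" "distr P borel snd = diff_measure \<beta> \<theta>"
    and dir: "AE p in P. case p of (x, y) \<Rightarrow> x \<le> y"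
    and tail: "\<And>x B. B \<in> sets borel \<Longrightarrow> emeasure P ({x<..} \<times> B) =
        emeasure (opt_target (diff_measure \<alpha> \<theta>) (diff_measure \<beta> \<theta>) x) B"
    using P by (auto simp: is_opt_directional_coupling_def directional_coupling_def)
  have sets_Id: "sets (Id_coupling \<theta>) = sets borel" by (simp add: Id_coupling_def)
  have diag: "(\<lambda>x. (x, x)) \<in> \<theta> \<rightarrow>\<^sub>M (borel :: (real \<times> real) measure)"
    unfolding measurable_cong_sets[OF \<theta> refl]
    by (intro borel_measurable_continuous_onI continuous_intros)
  have em: "emeasure (add_measure (Id_coupling \<theta>) P) A =
      emeasure \<theta> {x. (x, x) \<in> A} + emeasure P A" if "A \<in> sets borel" for A
    using that sets_Id sets_P
    by (simp add: emeasure_add_measure Id_coupling_def emeasure_distr[OF diag] vimage_def \<theta>.borel_UNIV)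
  have sum: "add_measure \<theta> (diff_measure \<alpha> \<theta>) = \<alpha>" "add_measure \<theta> (diff_measure \<beta> \<theta>) = \<beta>"
    by (intro add_measure_diff_measure le \<alpha>.finite_measure_axioms \<beta>.finite_measure_axioms
      \<theta>.finite_measure_axioms; simp add: \<theta> \<alpha>.M_is_borel \<beta>.M_is_borel)+
  have "AE p in add_measure (Id_coupling \<theta>) P. case p of (x, y) \<Rightarrow> x \<le> y"
  proof (rule AE_I)
    let ?N = "{p :: real \<times> real. \<not> (case p of (x, y) \<Rightarrow> x \<le> y)}"
    have "open {p :: real \<times> real. snd p < fst p}"
      by (intro open_Collect_less continuous_intros)
    also have "{p :: real \<times> real. snd p < fst p} = ?N"
      by auto
    finally have N: "?N \<in> sets borel"
      by (rule borel_open)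
    show "{p \<in> space (add_measure (Id_coupling \<theta>) P). \<not> (case p of (x, y) \<Rightarrow> x \<le> y)} \<subseteq> ?N" by auto
    have "emeasure P ?N = 0"
      using dir N sets_P sets_eq_imp_space_eq[OF sets_P] by (subst (asm) AE_iff_measurable) auto
    then show "emeasure (add_measure (Id_coupling \<theta>) P) ?N = 0"
      by (simp add: em N)
    show "?N \<in> sets (add_measure (Id_coupling \<theta>) P)" using N by (simp add: sets_Id)
  qed
  moreover have "distr (add_measure (Id_coupling \<theta>) P) borel fst = \<alpha>"
    "distr (add_measure (Id_coupling \<theta>) P) borel snd = \<beta>"
    using distr_add_Id_coupling[OF borel_measurable_fst _ \<theta> sets_P]
      distr_add_Id_coupling[OF borel_measurable_snd _ \<theta> sets_P]
    by (simp_all add: marginals sum)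
  moreover have "emeasure (add_measure (Id_coupling \<theta>) P) ({x<..} \<times> B) = emeasure (opt_target \<alpha> \<beta> x) B"
    if B: "B \<in> sets borel" for x B
  proof -
    have "{x<..} \<times> B \<in> sets borel"
      using B by (simp flip: borel_prod)
    then have "emeasure (add_measure (Id_coupling \<theta>) P) ({x<..} \<times> B) =
        emeasure \<theta> ({x<..} \<inter> B) + emeasure P ({x<..} \<times> B)"
      by (simp add: em Int_def)
    also have "emeasure \<theta> ({x<..} \<inter> B) = emeasure (density \<theta> (indicator {x<..})) B"
      using B by (intro emeasure_restricted[symmetric]) (auto simp: \<theta>)
    finally show ?thesis
      using B by (simp add: tail opt_target_add_common[OF le \<theta>] emeasure_add_measure \<theta>
        R.opt_target_eq R.target_def)
  qed
  ultimately show ?thesis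
    by (simp add: is_opt_directional_coupling_def directional_coupling_def sets_Id)
qed

text \<open>
  The identity holds for every measure below both \<open>\<alpha>\<close> and \<open>\<beta>\<close>; the maximal one, the common part, is
  the case of the final theorem.
\<close>

proposition opt_directional_coupling_add_common:
  assumes "\<theta> \<le> \<alpha>" "\<theta> \<le> \<beta>" "sets \<theta> = sets borel"
  shows "opt_directional_coupling \<alpha> \<beta> = add_measure (Id_coupling \<theta>)
    (opt_directional_coupling (diff_measure \<alpha> \<theta>) (diff_measure \<beta> \<theta>))"
proof -
  interpret R: st_ordered_pair "diff_measure \<alpha> \<theta>" "diff_measure \<beta> \<theta>"
    by (rule st_ordered_pair_diff_measure) fact+
  obtain P where P: "is_opt_directional_coupling (diff_measure \<alpha> \<theta>) (diff_measure \<beta> \<theta>) P"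
    by (rule R.exists_opt_directional_coupling)
  show ?thesis
    using opt_directional_coupling_eqI[OF P R.\<alpha>.finite_measure_axioms]
      opt_directional_coupling_eqI[OF is_opt_directional_coupling_add_common[OF assms P]
        \<alpha>.finite_measure_axioms]
    by simp
qed

end

theorem proposition2p6:
  fixes \<mu> \<nu> :: "real measure"
  assumes "real_distribution \<mu>" and "real_distribution \<nu>"
    and "\<mu> \<preceq>\<^sub>s\<^sub>t \<nu>"
  shows "opt_directional_coupling \<mu> \<nu> =
    add_measure
      (Id_coupling (common_part \<mu> \<nu>))
      (opt_directional_coupling
        (diff_measure \<mu> (common_part \<mu> \<nu>))
        (diff_measure \<nu> (common_part \<mu> \<nu>)))"
proof -
  interpret \<mu>: real_distribution \<mu> by fact
  interpret \<nu>: real_distribution \<nu> by fact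
  interpret st_ordered_pair \<mu> \<nu>
    by unfold_locales fact
  show ?thesis
    by (intro opt_directional_coupling_add_common common_part_le \<mu>.finite_measure_axioms
        \<nu>.finite_measure_axioms) (simp_all add: common_part_def)
qed

end
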